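(* Let $\mathbb{E}$ be a (finite-dimensional) Euclidean space, let $f\in\Gamma_0(\mathbb{E})$, let $(\bar x,\bar\lambda)\in\mathbb{E}\times\mathbb{R}_{++}$, and let $\omega:\mathbb{E}\to\mathbb{R}$ be strongly convex and twice continuously differentiable. Let $$P(x,\lambda):=\mathrm{argmin}_{u\in\mathbb{E}}\{f(u)+\omega^\pi(x-u,\lambda)\}\qquad((x,\lambda)\in\mathbb{E}\times\mathbb{R}).$$ Then $P$ is semismooth* at $((\bar x,\bar\lambda),P(\bar x,\bar\lambda))$ if $\partial f$ is semismooth* at $\left(P(\bar x,\bar\lambda),\ \nabla\omega\left(\tfrac1{\bar\lambda}[\bar x-P(\bar x,\bar\lambda)]\right)\right)$.
   Context: $\Gamma_0(\mathbb{E})$ denotes the closed proper convex functions $\mathbb{E}\to\mathbb{R}\cup\{+\infty\}$; $\partial f$ is the convex subdifferential; $\mathbb{R}_{++}=(0,\infty)$. The perspective map is $\omega^\pi(z,\lambda)=\lambda\omega(z/\lambda)$ if $\lambda>0$, $\omega^\pi(z,0)=\omega^\infty(z)$ (horizon/recession function), $\omega^\pi(z,\lambda)=+\infty$ if $\lambda<0$. For $\lambda>0$ the set $P(x,\lambda)$ is a singleton, identified with its element. For $A\subset\mathbb{E}$ and $\bar a\in A$: the tangent cone $T_A(\bar a)$ is the set of $z$ for which there exist $t_k\downarrow0$, $z_k\to z$ with $\bar a+t_kz_k\in A$; the regular normal cone is $\hat N_A(\bar a)=\{v\mid\langle v,z\rangle\le0\ \forall z\in T_A(\bar a)\}$ (empty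 if $\bar a\notin A$); the directional normal cone in direction $u$ is $N_A(\bar a;u)=\{v\mid\exists t_k\downarrow0,\ u_k\to u,\ v_k\to v,\ v_k\in\hat N_A(\bar a+t_ku_k)\}$. The set $A$ is semismooth* at $\bar a\in A$ if $\langle a^*,u\rangle=0$ for all $u\in\mathbb{E}$ and all $a^*\in N_A(\bar a;u)$. A set-valued map $S:\mathbb{E}_1\rightrightarrows\mathbb{E}_2$ is semismooth* at $(\bar x,\bar y)\in\mathrm{gph}\,S$ if the set $\mathrm{gph}\,S$ is semismooth* at $(\bar x,\bar y)$. *)

theory Defs
  imports "HOL-Analysis.Analysis"
begin

definition ereal_epigraph :: "('a \<Rightarrow> ereal) \<Rightarrow> ('a \<times> real) set" where
  "ereal_epigraph f = {(x, \<alpha>). f x \<le> ereal \<alpha>}"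

(* The class of closed proper convex functions with values in the reals and +infinity. *)
definition Gamma0 :: "('a::euclidean_space \<Rightarrow> ereal) set" where
  "Gamma0 = {f. (\<forall>x. f x \<noteq> -\<infinity>) \<and> (\<exists>x. f x \<noteq> \<infinity>)
      \<and> convex (ereal_epigraph f) \<and> closed (ereal_epigraph f)}"

definition subdifferential :: "('a::euclidean_space \<Rightarrow> ereal) \<Rightarrow> 'a \<Rightarrow> 'a set" where
  "subdifferential f x =
     {v. \<bar>f x\<bar> \<noteq> \<infinity> \<and> (\<forall>z. f x + ereal (v \<bullet> (z - x)) \<le> f z)}"

definition strongly_convex :: "('a::euclidean_space \<Rightarrow> real) \<Rightarrow> bool" where
  "strongly_convex \<omega> \<longleftrightarrow> (\<exists>\<sigma>>0. \<forall>x y t. 0 \<le> t \<and> t \<le> 1 \<longrightarrow>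
     \<omega> ((1 - t) *\<^sub>R x + t *\<^sub>R y)
       \<le> (1 - t) * \<omega> x + t * \<omega> y - \<sigma> / 2 * t * (1 - t) * (norm (x - y))\<^sup>2)"

definition gradient :: "('a::euclidean_space \<Rightarrow> real) \<Rightarrow> 'a \<Rightarrow> 'a" where
  "gradient \<omega> x = (THE g. GDERIV \<omega> x :> g)"

definition twice_continuously_differentiable :: "('a::euclidean_space \<Rightarrow> real) \<Rightarrow> bool" where
  "twice_continuously_differentiable \<omega> \<longleftrightarrow>
     (\<forall>x. \<omega> differentiable (at x)) \<and>
     (\<exists>H :: 'a \<Rightarrow> 'a \<Rightarrow>\<^sub>L 'a.
        (\<forall>x. (gradient \<omega> has_derivative blinfun_apply (H x)) (at x)) \<and>
        continuous_on UNIV H)"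

definition horizon_cone :: "'a::euclidean_space set \<Rightarrow> 'a set" where
  "horizon_cone C = {w. \<exists>(t :: nat \<Rightarrow> real) c. (\<forall>k. t k > 0) \<and> t \<longlonglongrightarrow> 0 \<and>
     (\<forall>k. c k \<in> C) \<and> (\<lambda>k. t k *\<^sub>R c k) \<longlonglongrightarrow> w}"

(* The function whose epigraph is the horizon cone of the epigraph. *)
definition horizon_function :: "('a::euclidean_space \<Rightarrow> real) \<Rightarrow> 'a \<Rightarrow> ereal" where
  "horizon_function \<omega> z = (INF \<alpha>\<in>{\<alpha>. (z, \<alpha>) \<in> horizon_cone (epigraph UNIV \<omega>)}. ereal \<alpha>)"

definition perspective :: "('a::euclidean_space \<Rightarrow> real) \<Rightarrow> 'a \<times> real \<Rightarrow> ereal" where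
  "perspective \<omega> = (\<lambda>(z, l).
     if l > 0 then ereal (l * \<omega> ((1 / l) *\<^sub>R z))
     else if l = 0 then horizon_function \<omega> z
     else \<infinity>)"

(* The set of minimizers is empty if the function is identically +infinity. *)
definition argmin_set :: "('a \<Rightarrow> ereal) \<Rightarrow> 'a set" where
  "argmin_set g = {u. g u \<noteq> \<infinity> \<and> (\<forall>v. g u \<le> g v)}"

definition prox_map :: "('a::euclidean_space \<Rightarrow> ereal) \<Rightarrow> ('a \<Rightarrow> real) \<Rightarrow> 'a \<times> real \<Rightarrow> 'a set" where
  "prox_map f \<omega> = (\<lambda>(x, l). argmin_set (\<lambda>u. f u + perspective \<omega> (x - u, l)))"

definition tangent_cone :: "'a::euclidean_space set \<Rightarrow> 'a \<Rightarrow> 'a set" where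
  "tangent_cone A a = {z. \<exists>(t :: nat \<Rightarrow> real) w. (\<forall>k. t k > 0) \<and> t \<longlonglongrightarrow> 0 \<and> w \<longlonglongrightarrow> z \<and>
     (\<forall>k. a + t k *\<^sub>R w k \<in> A)}"

definition regular_normal_cone :: "'a::euclidean_space set \<Rightarrow> 'a \<Rightarrow> 'a set" where
  "regular_normal_cone A a =
     (if a \<in> A then {v. \<forall>z\<in>tangent_cone A a. v \<bullet> z \<le> 0} else {})"

definition directional_normal_cone :: "'a::euclidean_space set \<Rightarrow> 'a \<Rightarrow> 'a \<Rightarrow> 'a set" where
  "directional_normal_cone A a u =
     {v. \<exists>(t :: nat \<Rightarrow> real) w y. (\<forall>k. t k > 0) \<and> t \<longlonglongrightarrow> 0 \<and> w \<longlonglongrightarrow> u \<and> y \<longlonglongrightarrow> v \<and>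
       (\<forall>k. y k \<in> regular_normal_cone A (a + t k *\<^sub>R w k))}"

definition semismooth_star_set :: "'a::euclidean_space set \<Rightarrow> 'a \<Rightarrow> bool" where
  "semismooth_star_set A a \<longleftrightarrow>
     a \<in> A \<and> (\<forall>u. \<forall>v\<in>directional_normal_cone A a u. v \<bullet> u = 0)"

definition gph :: "('a \<Rightarrow> 'b set) \<Rightarrow> ('a \<times> 'b) set" where
  "gph S = {(x, y). y \<in> S x}"

definition semismooth_star ::
    "('a::euclidean_space \<Rightarrow> 'b::euclidean_space set) \<Rightarrow> 'a \<times> 'b \<Rightarrow> bool" where
  "semismooth_star S p \<longleftrightarrow> semismooth_star_set (gph S) p"

end

theory Submission
  imports Defs
begin

text \<open>
  For \<open>\<lambda> > 0\<close> the optimality condition of the convex problem defining \<open>P(x, \<lambda>)\<close> reads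
  \<open>u \<in> P(x, \<lambda>)\<close> iff \<open>\<nabla>\<omega>((x - u) / \<lambda>) \<in> \<partial>f(u)\<close> (lemma \<open>mem_prox_map_iff\<close>). So, near points with
  \<open>\<lambda> > 0\<close>, the graph of \<open>P\<close> is the preimage of the graph of \<open>\<partial>f\<close> under the \<open>C\<^sup>1\<close> map
  \<open>F(x, \<lambda>, u) = (u, \<nabla>\<omega>((x - u) / \<lambda>))\<close>. Strong convexity makes every Hessian \<open>H(w)\<close> of \<open>\<omega>\<close>
  uniformly coercive, hence invertible, so \<open>F\<close> has surjective derivative, and the
  semismooth* property passes from a set to its preimage under such a map.

  The transfer is carried out with explicit normals. Put \<open>w = (x - u) / \<lambda>\<close>. The local inverse of
  \<open>\<nabla>\<omega>\<close> at \<open>w\<close> turns every tangent \<open>(du, dy)\<close> of the graph of \<open>\<partial>f\<close>, together with every real \<open>dl\<close>,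
  into the tangent \<open>((du + dl w + \<lambda> H(w)\<^sup>-\<^sup>1 dy, dl), du)\<close> of the graph of \<open>P\<close>. Dually, a
  regular normal \<open>((v1, v2), v3)\<close> to the graph of \<open>P\<close> satisfies \<open>v2 = - \<langle>v1, w\<rangle>\<close> and yields the
  regular normal \<open>(v1 + v3, \<lambda> a)\<close> to the graph of \<open>\<partial>f\<close>, where \<open>a\<close> is the solution of
  \<open>H(w)\<^sup>* a = v1\<close> (lemma \<open>regular_normal_subdifferential_of_prox_map\<close>). By coercivity, \<open>a\<close> depends
  continuously on \<open>(w, v1)\<close>, so the correspondence persists for limits along a direction, which is
  transformed by the derivative of \<open>F\<close>; the pairing of normal and direction is the same on both
  sides and therefore vanishes.
\<close>

section \<open>Tangents and directional normals from eventual conditions\<close>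

lemma tangent_coneI_eventually:
  fixes z :: "'a::euclidean_space"
  assumes t: "t \<longlonglongrightarrow> 0" and w: "w \<longlonglongrightarrow> z"
    and ev: "\<forall>\<^sub>F k in sequentially. t k > 0 \<and> a + t k *\<^sub>R w k \<in> A"
  shows "z \<in> tangent_cone A a"
proof -
  obtain N where N: "\<And>k. k \<ge> N \<Longrightarrow> t k > 0 \<and> a + t k *\<^sub>R w k \<in> A"
    using ev unfolding eventually_sequentially by blast
  show ?thesis
    unfolding tangent_cone_def mem_Collect_eq
    using N LIMSEQ_ignore_initial_segment[OF t, of N] LIMSEQ_ignore_initial_segment[OF w, of N]
    by (intro exI[of _ "\<lambda>k. t (k + N)"] exI[of _ "\<lambda>k. w (k + N)"]) auto
qed

lemma zero_mem_tangent_cone: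
  fixes a :: "'a::euclidean_space"
  assumes "a \<in> A"
  shows "0 \<in> tangent_cone A a"
  using assms LIMSEQ_inverse_real_of_nat
  by (intro tangent_coneI_eventually[of "\<lambda>n. inverse (real (Suc n))" "\<lambda>_. 0"])
     (auto intro!: always_eventually)

lemma directional_normal_coneI_eventually:
  fixes u v :: "'a::euclidean_space"
  assumes t: "t \<longlonglongrightarrow> 0" and w: "w \<longlonglongrightarrow> u" and y: "y \<longlonglongrightarrow> v"
    and ev: "\<forall>\<^sub>F k in sequentially. t k > 0 \<and> y k \<in> regular_normal_cone A (a + t k *\<^sub>R w k)"
  shows "v \<in> directional_normal_cone A a u"
proof -
  obtain N where N: "\<And>k. k \<ge> N \<Longrightarrow> t k > 0 \<and> y k \<in> regular_normal_cone A (a + t k *\<^sub>R w k)"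
    using ev unfolding eventually_sequentially by blast
  show ?thesis
    unfolding directional_normal_cone_def mem_Collect_eq
    using N LIMSEQ_ignore_initial_segment[OF t, of N] LIMSEQ_ignore_initial_segment[OF w, of N]
      LIMSEQ_ignore_initial_segment[OF y, of N]
    by (intro exI[of _ "\<lambda>k. t (k + N)"] exI[of _ "\<lambda>k. w (k + N)"] exI[of _ "\<lambda>k. y (k + N)"]) auto
qed

section \<open>Gradients and Hessians of strongly convex functions\<close>

text \<open>A Frechet derivative is a Hadamard derivative: the direction may vary with the step size.\<close>

lemma has_derivative_imp_hadamard:
  fixes f :: "'a::real_normed_vector \<Rightarrow> 'b::real_normed_vector"
  assumes f: "(f has_derivative f') (at x)"
    and t: "t \<longlonglongrightarrow> 0" "\<And>k. t k > 0" and w: "w \<longlonglongrightarrow> d"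
  shows "(\<lambda>k. (1 / t k) *\<^sub>R (f (x + t k *\<^sub>R w k) - f x)) \<longlonglongrightarrow> f' d"
proof -
  have bl: "bounded_linear f'"
    and ap: "\<And>e. e > 0 \<Longrightarrow> \<exists>r>0. \<forall>y. norm (y - x) < r \<longrightarrow>
      norm (f y - f x - f' (y - x)) \<le> e * norm (y - x)"
    using f unfolding has_derivative_at_alt by auto
  interpret bounded_linear f' by (fact bl)
  obtain B where B: "B > 0" "\<And>k. norm (w k) \<le> B"
    using convergent_imp_Bseq[of w] w unfolding convergent_def Bseq_def by blast
  have tw: "(\<lambda>k. t k *\<^sub>R w k) \<longlonglongrightarrow> 0"
    using tendsto_scaleR[OF t(1) w] by simp
  have "(\<lambda>k. (1 / t k) *\<^sub>R (f (x + t k *\<^sub>R w k) - f x) - f' (w k)) \<longlonglongrightarrow> 0"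
  proof (rule LIMSEQ_I)
    fix r :: real assume r: "r > 0"
    define e where "e = r / (2 * B)"
    have e: "e > 0" using r B by (simp add: e_def)
    obtain s where s: "s > 0" "\<And>y. norm (y - x) < s \<Longrightarrow>
      norm (f y - f x - f' (y - x)) \<le> e * norm (y - x)"
      using ap[OF e] by blast
    obtain N where N: "\<And>k. k \<ge> N \<Longrightarrow> norm (t k *\<^sub>R w k) < s"
      using LIMSEQ_D[OF tw s(1)] by auto
    have "norm ((1 / t k) *\<^sub>R (f (x + t k *\<^sub>R w k) - f x) - f' (w k) - 0) < r" if "k \<ge> N" for k
    proof -
      have "norm (f (x + t k *\<^sub>R w k) - f x - f' (t k *\<^sub>R w k)) \<le> e * norm (t k *\<^sub>R w k)"
        using s(2)[of "x + t k *\<^sub>R w k"] N[OF that] by simp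
      also have "\<dots> \<le> t k * (e * B)"
        using t(2)[of k] e B(2)[of k] by (simp add: mult.left_commute)
      finally have le: "norm (f (x + t k *\<^sub>R w k) - f x - f' (t k *\<^sub>R w k)) \<le> t k * (e * B)" .
      have "(1 / t k) *\<^sub>R (f (x + t k *\<^sub>R w k) - f x) - f' (w k)
          = (1 / t k) *\<^sub>R (f (x + t k *\<^sub>R w k) - f x - f' (t k *\<^sub>R w k))"
        using t(2)[of k] by (simp add: scaleR scaleR_diff_right)
      then have "norm ((1 / t k) *\<^sub>R (f (x + t k *\<^sub>R w k) - f x) - f' (w k)) \<le> e * B"
        using le t(2)[of k] by (simp add: divide_le_eq mult.commute)
      also have "\<dots> < r" using B r by (simp add: e_def)
      finally show ?thesis by simp
    qed
    then show "\<exists>N. \<forall>k\<ge>N.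
        norm ((1 / t k) *\<^sub>R (f (x + t k *\<^sub>R w k) - f x) - f' (w k) - 0) < r"
      by blast
  qed
  from tendsto_add[OF this tendsto[OF w]] show ?thesis by simp
qed

lemma has_derivative_gradient:
  fixes \<omega> :: "'a::euclidean_space \<Rightarrow> real"
  assumes "\<omega> differentiable (at x)"
  shows "(\<omega> has_derivative (\<lambda>h. gradient \<omega> x \<bullet> h)) (at x)"
proof -
  obtain D where D: "(\<omega> has_derivative D) (at x)"
    using assms unfolding differentiable_def by blast
  then have "linear D" by (rule has_derivative_linear)
  then have Dg: "D h = h \<bullet> adjoint D 1" for h
    by (simp add: adjoint_works)
  then have g: "GDERIV \<omega> x :> adjoint D 1"
    unfolding gderiv_def using D by (metis ext)
  have "g' = adjoint D 1" if "GDERIV \<omega> x :> g'" for g'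
  proof -
    have "h \<bullet> g' = h \<bullet> adjoint D 1" for h
      using has_derivative_unique[of \<omega>] that g unfolding gderiv_def by metis
    then show ?thesis
      by (metis vector_eq_rdot inner_commute)
  qed
  then have "gradient \<omega> x = adjoint D 1"
    unfolding gradient_def using g by blast
  with g show ?thesis by (simp add: gderiv_def inner_commute)
qed

lemma strongly_convex_gradient_inequality:
  fixes \<omega> :: "'a::euclidean_space \<Rightarrow> real"
  assumes "strongly_convex \<omega>" and diff: "\<And>x. \<omega> differentiable (at x)"
  obtains \<sigma> where "\<sigma> > 0"
    "\<And>x y. \<omega> x + gradient \<omega> x \<bullet> (y - x) + \<sigma> / 2 * (norm (y - x))\<^sup>2 \<le> \<omega> y"
proof -
  obtain \<sigma> where s: "\<sigma> > 0" and sc: "\<And>x y t. 0 \<le> t \<Longrightarrow> t \<le> 1 \<Longrightarrow>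
     \<omega> ((1 - t) *\<^sub>R x + t *\<^sub>R y)
       \<le> (1 - t) * \<omega> x + t * \<omega> y - \<sigma> / 2 * t * (1 - t) * (norm (x - y))\<^sup>2"
    using assms unfolding strongly_convex_def by blast
  have "\<omega> x + gradient \<omega> x \<bullet> (y - x) + \<sigma> / 2 * (norm (y - x))\<^sup>2 \<le> \<omega> y" for x y
  proof -
    define t where "t k = inverse (real (Suc k))" for k
    have t: "t \<longlonglongrightarrow> 0" "\<And>k. t k > 0" "\<And>k. t k \<le> 1"
      using LIMSEQ_inverse_real_of_nat by (auto simp: t_def[abs_def] inverse_le_1_iff)
    have lim: "(\<lambda>k. (1 / t k) *\<^sub>R (\<omega> (x + t k *\<^sub>R (y - x)) - \<omega> x)) \<longlonglongrightarrow> gradient \<omega> x \<bullet> (y - x)"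
      by (rule has_derivative_imp_hadamard[OF has_derivative_gradient[OF diff] t(1,2) tendsto_const])
    have lim': "(\<lambda>k. \<omega> y - \<omega> x - \<sigma> / 2 * (1 - t k) * (norm (x - y))\<^sup>2)
        \<longlonglongrightarrow> \<omega> y - \<omega> x - \<sigma> / 2 * (1 - 0) * (norm (x - y))\<^sup>2"
      by (intro tendsto_intros t)
    have "gradient \<omega> x \<bullet> (y - x) \<le> \<omega> y - \<omega> x - \<sigma> / 2 * (1 - 0) * (norm (x - y))\<^sup>2"
    proof (rule LIMSEQ_le[OF lim lim'], intro exI allI impI)
      fix k
      have eq: "x + t k *\<^sub>R (y - x) = (1 - t k) *\<^sub>R x + t k *\<^sub>R y"
        by (simp add: algebra_simps)
      have "\<omega> (x + t k *\<^sub>R (y - x)) - \<omega> x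
          \<le> t k * (\<omega> y - \<omega> x - \<sigma> / 2 * (1 - t k) * (norm (x - y))\<^sup>2)"
        unfolding eq using sc[of "t k" x y] t(2,3)[of k] by (simp add: algebra_simps)
      then show "(1 / t k) *\<^sub>R (\<omega> (x + t k *\<^sub>R (y - x)) - \<omega> x)
          \<le> \<omega> y - \<omega> x - \<sigma> / 2 * (1 - t k) * (norm (x - y))\<^sup>2"
        using t(2)[of k] by (simp add: divide_le_eq mult.commute)
    qed
    then show ?thesis by (simp add: norm_minus_commute)
  qed
  with s that show thesis by blast
qed

text \<open>The Hessians of a strongly convex function are coercive, uniformly in the base point.\<close>

lemma strongly_convex_hessian_coercive:
  fixes \<omega> :: "'a::euclidean_space \<Rightarrow> real"
  assumes sc: "strongly_convex \<omega>" and diff: "\<And>x. \<omega> differentiable (at x)"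
    and H: "\<And>x. (gradient \<omega> has_derivative H x) (at x)"
  obtains \<sigma> where "\<sigma> > 0" "\<And>x d. \<sigma> * (norm d)\<^sup>2 \<le> H x d \<bullet> d"
proof -
  obtain \<sigma> where s: "\<sigma> > 0"
    and gi: "\<And>x y. \<omega> x + gradient \<omega> x \<bullet> (y - x) + \<sigma> / 2 * (norm (y - x))\<^sup>2 \<le> \<omega> y"
    using strongly_convex_gradient_inequality[OF sc diff] by blast
  have mono: "\<sigma> * (norm (y - x))\<^sup>2 \<le> (gradient \<omega> y - gradient \<omega> x) \<bullet> (y - x)" for x y
    using gi[of x y] gi[of y x] by (simp add: norm_minus_commute algebra_simps inner_diff_right)
  have "\<sigma> * (norm d)\<^sup>2 \<le> H x d \<bullet> d" for x d
  proof -
    define t where "t k = inverse (real (Suc k))" for k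
    have t: "t \<longlonglongrightarrow> 0" "\<And>k. t k > 0"
      using LIMSEQ_inverse_real_of_nat by (auto simp: t_def[abs_def])
    have "(\<lambda>k. ((1 / t k) *\<^sub>R (gradient \<omega> (x + t k *\<^sub>R d) - gradient \<omega> x)) \<bullet> d) \<longlonglongrightarrow> H x d \<bullet> d"
      by (intro tendsto_inner has_derivative_imp_hadamard[OF H t] tendsto_const)
    moreover have
      "\<sigma> * (norm d)\<^sup>2 \<le> ((1 / t k) *\<^sub>R (gradient \<omega> (x + t k *\<^sub>R d) - gradient \<omega> x)) \<bullet> d" for k
    proof -
      have "t k * (t k * (\<sigma> * (norm d)\<^sup>2))
          \<le> t k * ((gradient \<omega> (x + t k *\<^sub>R d) - gradient \<omega> x) \<bullet> d)"
        using mono[of "x + t k *\<^sub>R d" x] t(2)[of k]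
        by (simp add: power_mult_distrib power2_eq_square mult_ac)
      then have "t k * (\<sigma> * (norm d)\<^sup>2) \<le> (gradient \<omega> (x + t k *\<^sub>R d) - gradient \<omega> x) \<bullet> d"
        using t(2)[of k] by simp
      then show ?thesis
        using t(2)[of k] by (simp add: le_divide_eq mult.commute)
    qed
    ultimately show ?thesis
      by (intro LIMSEQ_le_const) auto
  qed
  with s that show thesis by blast
qed

section \<open>Coercive linear maps\<close>

lemma coercive_imp_inj:
  fixes A :: "'a::euclidean_space \<Rightarrow> 'a"
  assumes "linear A" "\<sigma> > 0" and co: "\<And>d. \<sigma> * (norm d)\<^sup>2 \<le> A d \<bullet> d"
  shows "inj A"
proof -
  have "d = 0" if "A d = 0" for d
    using co[of d] that \<open>\<sigma> > 0\<close> by (simp add: mult_le_0_iff)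
  then show ?thesis
    using linear_injective_0[OF assms(1)] by blast
qed

lemma coercive_adjoint_solvable:
  fixes A :: "'a::euclidean_space \<Rightarrow> 'a"
  assumes "linear A" "\<sigma> > 0" "\<And>d. \<sigma> * (norm d)\<^sup>2 \<le> A d \<bullet> d"
  shows "\<exists>a. \<forall>d. a \<bullet> A d = b \<bullet> d"
proof -
  have "surj (adjoint A)"
    using coercive_imp_inj[OF assms] assms(1) by simp
  then obtain a where "adjoint A a = b" by (metis surjD)
  then show ?thesis
    using adjoint_clauses(2)[OF assms(1)] by metis
qed

text \<open>
  The solution \<open>a\<close> of \<open>A\<^sup>* a = b\<close> depends continuously on the map and on the right-hand side
  within a uniformly coercive family; inverses of operators are not needed for this.
\<close>

lemma coercive_adjoint_solution_tendsto:
  fixes A :: "nat \<Rightarrow> 'a::euclidean_space \<Rightarrow>\<^sub>L 'a"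
  assumes s: "\<sigma> > 0" and co: "\<And>k d. \<sigma> * (norm d)\<^sup>2 \<le> A k d \<bullet> d"
    and A: "A \<longlonglongrightarrow> A'" and b: "b \<longlonglongrightarrow> b'"
    and a: "\<And>k d. a k \<bullet> A k d = b k \<bullet> d" and a': "\<And>d. a' \<bullet> A' d = b' \<bullet> d"
  shows "a \<longlonglongrightarrow> a'"
proof -
  have bound: "norm (a k - a') \<le> (norm (b k - b') + norm (A k - A') * norm a') / \<sigma>" for k
  proof (cases "a k = a'")
    case True
    then show ?thesis using s by simp
  next
    case False
    define d where "d = a k - a'"
    have d: "norm d > 0" using False by (simp add: d_def)
    have eq: "A k d \<bullet> d = (b k - b') \<bullet> d - a' \<bullet> (A k - A') d"
      using a[of k d] a'[of d]
      by (simp add: d_def blinfun.diff_left inner_diff_left inner_diff_right inner_commute)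
    have "\<bar>a' \<bullet> (A k - A') d\<bar> \<le> norm a' * (norm (A k - A') * norm d)"
      by (rule order_trans[OF Cauchy_Schwarz_ineq2]) (simp add: mult_left_mono norm_blinfun)
    moreover have "(b k - b') \<bullet> d \<le> norm (b k - b') * norm d"
      by (rule norm_cauchy_schwarz)
    ultimately have "norm d * (\<sigma> * norm d) \<le> norm d * (norm (b k - b') + norm (A k - A') * norm a')"
      using co[of d k] unfolding eq by (simp add: power2_eq_square algebra_simps)
    then have "\<sigma> * norm d \<le> norm (b k - b') + norm (A k - A') * norm a'"
      using d by simp
    then show ?thesis
      using s by (simp add: d_def le_divide_eq mult.commute)
  qed
  have "(\<lambda>k. (norm (b k - b') + norm (A k - A') * norm a') / \<sigma>) \<longlonglongrightarrow> (0 + 0 * norm a') / \<sigma>"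
    by (intro tendsto_intros tendsto_norm_zero) (use s A b in \<open>auto simp: LIM_zero_iff\<close>)
  then have lim0: "(\<lambda>k. (norm (b k - b') + norm (A k - A') * norm a') / \<sigma>) \<longlonglongrightarrow> 0"
    by simp
  have "(\<lambda>k. a k - a') \<longlonglongrightarrow> 0"
    by (rule Lim_null_comparison[OF always_eventually lim0]) (simp add: bound)
  then show ?thesis by (rule LIM_zero_cancel)
qed

section \<open>Optimality condition for the proximal map\<close>

lemma Gamma0_convex_combination:
  assumes f: "f \<in> Gamma0" and "f u = ereal a" "f z = ereal b" "0 \<le> t" "t \<le> 1"
  shows "f ((1 - t) *\<^sub>R u + t *\<^sub>R z) \<le> ereal ((1 - t) * a + t * b)"
proof -
  have "convex (ereal_epigraph f)" using f by (simp add: Gamma0_def)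
  moreover have "(u, a) \<in> ereal_epigraph f" "(z, b) \<in> ereal_epigraph f"
    using assms by (auto simp: ereal_epigraph_def)
  ultimately have "(1 - t) *\<^sub>R (u, a) + t *\<^sub>R (z, b) \<in> ereal_epigraph f"
    using assms unfolding convex_alt by blast
  then show ?thesis by (simp add: ereal_epigraph_def)
qed

lemma mem_prox_map_iff:
  fixes f :: "'a::euclidean_space \<Rightarrow> ereal"
  assumes f: "f \<in> Gamma0" and l: "l > 0"
    and sc: "strongly_convex \<omega>" and diff: "\<And>x. \<omega> differentiable (at x)"
  shows "u \<in> prox_map f \<omega> (x, l) \<longleftrightarrow>
    gradient \<omega> ((1 / l) *\<^sub>R (x - u)) \<in> subdifferential f u"
proof -
  define w where "w = (1 / l) *\<^sub>R (x - u)"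
  define g where "g = gradient \<omega> w"
  have ninf: "f z \<noteq> -\<infinity>" for z using f by (auto simp: Gamma0_def)
  have prox: "u \<in> prox_map f \<omega> (x, l) \<longleftrightarrow> f u \<noteq> \<infinity> \<and>
     (\<forall>z. f u + ereal (l * \<omega> w) \<le> f z + ereal (l * \<omega> ((1 / l) *\<^sub>R (x - z))))"
    using l by (simp add: prox_map_def argmin_set_def perspective_def w_def)
  show ?thesis unfolding w_def[symmetric] g_def[symmetric]
  proof
    assume "u \<in> prox_map f \<omega> (x, l)"
    then have fu: "f u \<noteq> \<infinity>"
      and min: "\<And>z. f u + ereal (l * \<omega> w) \<le> f z + ereal (l * \<omega> ((1 / l) *\<^sub>R (x - z)))"
      using prox by auto
    obtain a where a: "f u = ereal a" using fu ninf[of u] by (cases "f u") auto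
    have "f u + ereal (g \<bullet> (z - u)) \<le> f z" for z
    proof (cases "f z")
      case (real b)
      define t where "t k = inverse (real (Suc k))" for k
      have t: "t \<longlonglongrightarrow> 0" "\<And>k. t k > 0" "\<And>k. t k \<le> 1"
        using LIMSEQ_inverse_real_of_nat by (auto simp: t_def[abs_def] inverse_le_1_iff)
      define d where "d = (- (1 / l)) *\<^sub>R (z - u)"
      have lim: "(\<lambda>k. (1 / t k) *\<^sub>R (\<omega> (w + t k *\<^sub>R d) - \<omega> w)) \<longlonglongrightarrow> g \<bullet> d"
        unfolding g_def
        by (rule has_derivative_imp_hadamard[OF has_derivative_gradient[OF diff] t(1,2) tendsto_const])
      \<comment> \<open>Compare \<open>u\<close> with the points \<open>u + t (z - u)\<close> of the segment towards \<open>z\<close> as \<open>t\<close> tends to 0.\<close>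
      have "- (b - a) / l \<le> g \<bullet> d"
      proof (rule LIMSEQ_le_const[OF lim], intro exI allI impI)
        fix k
        define p where "p = (1 - t k) *\<^sub>R u + t k *\<^sub>R z"
        have wp: "(1 / l) *\<^sub>R (x - p) = w + t k *\<^sub>R d"
          by (simp add: p_def w_def d_def algebra_simps)
        have "ereal (a + l * \<omega> w) \<le> f p + ereal (l * \<omega> (w + t k *\<^sub>R d))"
          using min[of p] a unfolding wp by simp
        also have "\<dots> \<le> ereal ((1 - t k) * a + t k * b) + ereal (l * \<omega> (w + t k *\<^sub>R d))"
          unfolding p_def
          using Gamma0_convex_combination[OF f a real, of "t k"] t(2,3)[of k]
          by (intro add_right_mono) simp
        finally have "- (t k * (b - a)) \<le> l * (\<omega> (w + t k *\<^sub>R d) - \<omega> w)"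
          by (simp add: algebra_simps)
        then show "- (b - a) / l \<le> (1 / t k) *\<^sub>R (\<omega> (w + t k *\<^sub>R d) - \<omega> w)"
          using l t(2)[of k] by (simp add: field_simps)
      qed
      moreover have "g \<bullet> d = - (g \<bullet> (z - u)) / l"
        by (simp add: d_def)
      ultimately have "g \<bullet> (z - u) \<le> b - a"
        using l by (simp add: divide_le_eq)
      then show ?thesis using a real by simp
    qed (use ninf in auto)
    with a show "g \<in> subdifferential f u" by (simp add: subdifferential_def)
  next
    assume "g \<in> subdifferential f u"
    then have fu: "\<bar>f u\<bar> \<noteq> \<infinity>" and sub: "\<And>z. f u + ereal (g \<bullet> (z - u)) \<le> f z"
      by (auto simp: subdifferential_def)
    obtain a where a: "f u = ereal a" using fu by (cases "f u") auto
    obtain \<sigma> where s: "\<sigma> > 0"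
      and gi: "\<And>x y. \<omega> x + gradient \<omega> x \<bullet> (y - x) + \<sigma> / 2 * (norm (y - x))\<^sup>2 \<le> \<omega> y"
      using strongly_convex_gradient_inequality[OF sc diff] by blast
    have "f u + ereal (l * \<omega> w) \<le> f z + ereal (l * \<omega> ((1 / l) *\<^sub>R (x - z)))" for z
    proof (cases "f z")
      case (real b)
      define w' where "w' = (1 / l) *\<^sub>R (x - z)"
      have d: "w' - w = (1 / l) *\<^sub>R (u - z)"
        by (simp add: w_def w'_def algebra_simps)
      have "\<omega> w + g \<bullet> (w' - w) \<le> \<omega> w'"
        using gi[of w w'] s unfolding g_def
        by (smt (verit) mult_nonneg_nonneg zero_le_power2 half_gt_zero)
      then have "l * (\<omega> w + g \<bullet> (w' - w)) \<le> l * \<omega> w'"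
        using l by simp
      then have "l * \<omega> w + g \<bullet> (u - z) \<le> l * \<omega> w'"
        unfolding d distrib_left inner_scaleR_right using l by simp
      moreover have "a + g \<bullet> (z - u) \<le> b"
        using sub[of z] a real by simp
      ultimately show ?thesis
        using a real unfolding w'_def by (simp add: inner_diff_right)
    qed (use ninf in auto)
    then show "u \<in> prox_map f \<omega> (x, l)" using prox a by simp
  qed
qed

section \<open>Regular normals to the graph of the proximal map\<close>

lemma coercive_derivative_local_inverse:
  fixes G :: "'a::euclidean_space \<Rightarrow> 'a" and H :: "'a \<Rightarrow> 'a \<Rightarrow>\<^sub>L 'a"
  assumes H: "\<And>x. (G has_derivative H x) (at x)" and cont: "continuous_on UNIV H"
    and "\<sigma> > 0" and co: "\<And>d. \<sigma> * (norm d)\<^sup>2 \<le> H w d \<bullet> d"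
  obtains V g g' where "open V" "G w \<in> V" "\<And>y. y \<in> V \<Longrightarrow> G (g y) = y" "g (G w) = w"
    "(g has_derivative g') (at (G w))" "\<And>d. H w (g' d) = d"
proof -
  have lin: "linear (blinfun_apply (H w))"
    by (simp add: blinfun.bounded_linear_right bounded_linear.linear)
  have inj: "inj (blinfun_apply (H w))"
    by (rule coercive_imp_inj[OF lin \<open>\<sigma> > 0\<close> co])
  obtain h where h: "linear h" "h \<circ> blinfun_apply (H w) = id"
    using linear_injective_left_inverse[OF lin inj] by blast
  have bh: "bounded_linear h" using h(1) by (simp add: linear_conv_bounded_linear)
  have "Blinfun h o\<^sub>L H w = id_blinfun"
    by (rule blinfun_eqI)
       (use h(2) in \<open>simp add: bounded_linear_Blinfun_apply[OF bh] fun_eq_iff\<close>)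
  then obtain U V g g' where V: "w \<in> U" "open V" "G w \<in> V" "homeomorphism U V G g"
    and g: "\<And>y. y \<in> V \<Longrightarrow> (g has_derivative g' y) (at y)"
    and g': "\<And>y. y \<in> V \<Longrightarrow> g' y = inv (blinfun_apply (H (g y)))"
    and bij: "\<And>y. y \<in> V \<Longrightarrow> bij (blinfun_apply (H (g y)))"
    using inverse_function_theorem[OF open_UNIV H cont UNIV_I] by metis
  have gw: "g (G w) = w" using V by (simp add: homeomorphism_apply1)
  show thesis
  proof
    show "open V" "G w \<in> V" "g (G w) = w" using V gw by auto
    show "G (g y) = y" if "y \<in> V" for y using V that by (simp add: homeomorphism_apply2)
    show "(g has_derivative g' (G w)) (at (G w))" using g V by blast
    show "H w (g' (G w) d) = d" for d
      using g'[OF V(3)] bij[OF V(3)] gw by (simp add: bij_is_surj surj_f_inv_f)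
  qed
qed

text \<open>
  Tangents of the graph of \<open>\<partial>f\<close> lift to tangents of the graph of the proximal map, along the
  parametrization \<open>(u, y, l) \<mapsto> ((u + l (\<nabla>\<omega>)\<^sup>-\<^sup>1 y, l), u)\<close>.
\<close>

lemma tangent_cone_gph_prox_map:
  fixes f :: "'a::euclidean_space \<Rightarrow> ereal" and H :: "'a \<Rightarrow> 'a \<Rightarrow>\<^sub>L 'a"
  assumes f: "f \<in> Gamma0" and l: "l > 0"
    and sc: "strongly_convex \<omega>" and diff: "\<And>x. \<omega> differentiable (at x)"
    and H: "\<And>x. (gradient \<omega> has_derivative H x) (at x)" and cont: "continuous_on UNIV H"
    and w: "w = (1 / l) *\<^sub>R (x - u)"
    and tan: "(du, H w e) \<in> tangent_cone (gph (subdifferential f)) (u, gradient \<omega> w)"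
  shows "((du + l *\<^sub>R e + dl *\<^sub>R w, dl), du) \<in> tangent_cone (gph (prox_map f \<omega>)) ((x, l), u)"
proof -
  obtain \<sigma> where s: "\<sigma> > 0" "\<And>x d. \<sigma> * (norm d)\<^sup>2 \<le> H x d \<bullet> d"
    using strongly_convex_hessian_coercive[OF sc diff H] by blast
  obtain V g g' where V: "open V" "gradient \<omega> w \<in> V" "\<And>y. y \<in> V \<Longrightarrow> gradient \<omega> (g y) = y"
      "g (gradient \<omega> w) = w"
    and g: "(g has_derivative g') (at (gradient \<omega> w))" and g': "\<And>d. H w (g' d) = d"
    using coercive_derivative_local_inverse[OF H cont s(1) s(2)] by metis
  have lin: "linear (blinfun_apply (H w))"
    by (simp add: blinfun.bounded_linear_right bounded_linear.linear)
  have "inj (blinfun_apply (H w))"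
    by (rule coercive_imp_inj[OF lin s])
  then have g'e: "g' (H w e) = e"
    using g'[of "H w e"] by (simp add: inj_eq)
  obtain t p where t: "\<And>k. t k > 0" "t \<longlonglongrightarrow> 0" and p: "p \<longlonglongrightarrow> (du, H w e)"
    and mem: "\<And>k. (u, gradient \<omega> w) + t k *\<^sub>R p k \<in> gph (subdifferential f)"
    using tan unfolding tangent_cone_def by blast
  define q where "q k = fst (p k)" for k
  define r where "r k = snd (p k)" for k
  define y where "y k = gradient \<omega> w + t k *\<^sub>R r k" for k
  have q: "q \<longlonglongrightarrow> du" and r: "r \<longlonglongrightarrow> H w e"
    using tendsto_fst[OF p] tendsto_snd[OF p] by (simp_all add: q_def[abs_def] r_def[abs_def])
  have sub: "y k \<in> subdifferential f (u + t k *\<^sub>R q k)" for k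
    using mem[of k] by (simp add: gph_def y_def q_def r_def plus_prod_def)
  have y: "y \<longlonglongrightarrow> gradient \<omega> w"
    using tendsto_add[OF tendsto_const tendsto_scaleR[OF t(2) r]] by (simp add: y_def[abs_def])
  have gy: "(\<lambda>k. g (y k)) \<longlonglongrightarrow> w"
    using isCont_tendsto_compose[OF has_derivative_continuous[OF g] y] V(4) by simp
  have quot: "(\<lambda>k. (1 / t k) *\<^sub>R (g (y k) - w)) \<longlonglongrightarrow> e"
    using has_derivative_imp_hadamard[OF g t(2,1) r] by (simp add: y_def V(4) g'e)
  \<comment> \<open>The difference quotients of the lifted curve.\<close>
  define z where "z k = ((q k + l *\<^sub>R ((1 / t k) *\<^sub>R (g (y k) - w)) + dl *\<^sub>R g (y k), dl), q k)" for k
  show ?thesis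
  proof (rule tangent_coneI_eventually[OF t(2), where w = z])
    show "z \<longlonglongrightarrow> ((du + l *\<^sub>R e + dl *\<^sub>R w, dl), du)"
      unfolding z_def[abs_def] by (intro tendsto_intros q quot gy)
    have "(\<lambda>k. l + t k * dl) \<longlonglongrightarrow> l + 0 * dl"
      by (intro tendsto_intros t)
    then have "\<forall>\<^sub>F k in sequentially. l + t k * dl > 0"
      using l by (simp add: order_tendstoD(1))
    moreover have "\<forall>\<^sub>F k in sequentially. y k \<in> V"
      by (rule topological_tendstoD[OF y V(1,2)])
    ultimately show "\<forall>\<^sub>F k in sequentially. t k > 0 \<and>
        ((x, l), u) + t k *\<^sub>R z k \<in> gph (prox_map f \<omega>)"
    proof eventually_elim
      case (elim k)
      define u' where "u' = u + t k *\<^sub>R q k"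
      define l' where "l' = l + t k * dl"
      have "x = u + l *\<^sub>R w" using l by (simp add: w)
      then have eq: "((x, l), u) + t k *\<^sub>R z k = ((u' + l' *\<^sub>R g (y k), l'), u')"
        using t(1)[of k]
        by (simp add: z_def u'_def l'_def algebra_simps)
      have "u' \<in> prox_map f \<omega> (u' + l' *\<^sub>R g (y k), l')"
        using sub[of k] V(3)[OF elim(2)] elim(1)
        by (subst mem_prox_map_iff[OF f _ sc diff]) (simp_all add: u'_def l'_def)
      then show ?case
        unfolding eq using t(1) by (simp add: gph_def)
    qed
  qed
qed

lemma regular_normal_subdifferential_of_prox_map:
  fixes f :: "'a::euclidean_space \<Rightarrow> ereal" and H :: "'a \<Rightarrow> 'a \<Rightarrow>\<^sub>L 'a"
  assumes f: "f \<in> Gamma0" and l: "l > 0"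
    and sc: "strongly_convex \<omega>" and diff: "\<And>x. \<omega> differentiable (at x)"
    and H: "\<And>x. (gradient \<omega> has_derivative H x) (at x)" and cont: "continuous_on UNIV H"
    and w: "w = (1 / l) *\<^sub>R (x - u)"
    and v: "((v1, v2), v3) \<in> regular_normal_cone (gph (prox_map f \<omega>)) ((x, l), u)"
    and a: "\<And>d. a \<bullet> H w d = v1 \<bullet> d"
  shows "v2 = - (v1 \<bullet> w)"
    and "(v1 + v3, l *\<^sub>R a) \<in> regular_normal_cone (gph (subdifferential f)) (u, gradient \<omega> w)"
proof -
  let ?C = "gph (subdifferential f)"
  let ?y = "gradient \<omega> w"
  have "((x, l), u) \<in> gph (prox_map f \<omega>)"
    and nor: "\<And>z. z \<in> tangent_cone (gph (prox_map f \<omega>)) ((x, l), u) \<Longrightarrow> ((v1, v2), v3) \<bullet> z \<le> 0"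
    using v unfolding regular_normal_cone_def by (auto split: if_splits)
  then have mem: "(u, ?y) \<in> ?C"
    using mem_prox_map_iff[OF f l sc diff] by (simp add: gph_def w)
  have key: "v1 \<bullet> (du + l *\<^sub>R e + dl *\<^sub>R w) + v2 * dl + v3 \<bullet> du \<le> 0"
    if "(du, H w e) \<in> tangent_cone ?C (u, ?y)" for du e dl
    using nor[OF tangent_cone_gph_prox_map[OF f l sc diff H cont w that, of dl]] by simp
  \<comment> \<open>The zero tangent lifts to the tangents along the parameter \<open>l\<close>, in both orientations.\<close>
  have "(0, H w 0) \<in> tangent_cone ?C (u, ?y)"
    using zero_mem_tangent_cone[OF mem] by (simp add: zero_prod_def blinfun.zero_right)
  from key[OF this, of 1] key[OF this, of "-1"] show "v2 = - (v1 \<bullet> w)"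
    by simp
  obtain \<sigma> where s: "\<sigma> > 0" "\<And>x d. \<sigma> * (norm d)\<^sup>2 \<le> H x d \<bullet> d"
    using strongly_convex_hessian_coercive[OF sc diff H] by blast
  have lin: "linear (blinfun_apply (H w))"
    by (simp add: blinfun.bounded_linear_right bounded_linear.linear)
  have "surj (blinfun_apply (H w))"
    using linear_injective_imp_surjective[OF lin coercive_imp_inj[OF lin s]] by simp
  have "(v1 + v3, l *\<^sub>R a) \<bullet> z \<le> 0" if z: "z \<in> tangent_cone ?C (u, ?y)" for z
  proof -
    obtain du dy where zz: "z = (du, dy)" by (cases z)
    obtain e where e: "dy = H w e" using \<open>surj (blinfun_apply (H w))\<close> by (metis surjD)
    have "v1 \<bullet> (du + l *\<^sub>R e) + v3 \<bullet> du \<le> 0"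
      using key[of du e 0] z by (simp add: zz e)
    then show ?thesis
      by (simp add: zz e a inner_add_left inner_add_right)
  qed
  with mem show "(v1 + v3, l *\<^sub>R a) \<in> regular_normal_cone ?C (u, ?y)"
    by (simp add: regular_normal_cone_def)
qed

section \<open>Semismoothness* of the proximal map\<close>

theorem corollary3:
  fixes f :: "'a::euclidean_space \<Rightarrow> ereal"
    and \<omega> :: "'a \<Rightarrow> real"
    and xbar :: 'a and lbar :: real
  assumes "f \<in> Gamma0"
    and "lbar > 0"
    and "strongly_convex \<omega>"
    and "twice_continuously_differentiable \<omega>"
    and "semismooth_star (subdifferential f)
           (the_elem (prox_map f \<omega> (xbar, lbar)),
            gradient \<omega> ((1 / lbar) *\<^sub>R (xbar - the_elem (prox_map f \<omega> (xbar, lbar)))))"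
  shows "semismooth_star (prox_map f \<omega>)
           ((xbar, lbar), the_elem (prox_map f \<omega> (xbar, lbar)))"
proof -
  define u where "u = the_elem (prox_map f \<omega> (xbar, lbar))"
  define w where "w = (1 / lbar) *\<^sub>R (xbar - u)"
  let ?C = "gph (subdifferential f)"
  let ?P = "gph (prox_map f \<omega>)"
  have diff: "\<And>x. \<omega> differentiable (at x)"
    using assms(4) by (simp add: twice_continuously_differentiable_def)
  obtain H :: "'a \<Rightarrow> 'a \<Rightarrow>\<^sub>L 'a" where
    H: "\<And>x. (gradient \<omega> has_derivative H x) (at x)" and cont: "continuous_on UNIV H"
    using assms(4) unfolding twice_continuously_differentiable_def by blast
  obtain \<sigma> where s: "\<sigma> > 0" "\<And>x d. \<sigma> * (norm d)\<^sup>2 \<le> H x d \<bullet> d"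
    using strongly_convex_hessian_coercive[OF assms(3) diff H] by blast
  have solve: "\<exists>a. \<forall>d. a \<bullet> H x d = b \<bullet> d" for x b
    by (rule coercive_adjoint_solvable[OF _ s])
       (simp add: blinfun.bounded_linear_right bounded_linear.linear)
  have ss: "(u, gradient \<omega> w) \<in> ?C"
    "\<And>d n. n \<in> directional_normal_cone ?C (u, gradient \<omega> w) d \<Longrightarrow> n \<bullet> d = 0"
    using assms(5) unfolding semismooth_star_def semismooth_star_set_def u_def w_def by auto
  have "((xbar, lbar), u) \<in> ?P"
    using ss(1) mem_prox_map_iff[OF assms(1,2,3) diff, where u = u and x = xbar]
    by (simp add: gph_def w_def)
  moreover have "v \<bullet> d = 0" if v: "v \<in> directional_normal_cone ?P ((xbar, lbar), u) d" for v d
  proof -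
    obtain v1 v2 v3 where v_eq: "v = ((v1, v2), v3)" by (metis surj_pair)
    obtain dx dl du where d_eq: "d = ((dx, dl), du)" by (metis surj_pair)
    obtain t p n where t: "\<And>k. t k > 0" "t \<longlonglongrightarrow> 0" and p: "p \<longlonglongrightarrow> d" and n: "n \<longlonglongrightarrow> v"
      and nor: "\<And>k. n k \<in> regular_normal_cone ?P (((xbar, lbar), u) + t k *\<^sub>R p k)"
      using v unfolding directional_normal_cone_def by blast
    define px where "px k = fst (fst (p k))" for k
    define pl where "pl k = snd (fst (p k))" for k
    define pu where "pu k = snd (p k)" for k
    define n1 where "n1 k = fst (fst (n k))" for k
    define n2 where "n2 k = snd (fst (n k))" for k
    define n3 where "n3 k = snd (n k)" for k
    have px: "px \<longlonglongrightarrow> dx" and pl: "pl \<longlonglongrightarrow> dl" and pu: "pu \<longlonglongrightarrow> du"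
      using tendsto_fst[OF tendsto_fst[OF p]] tendsto_snd[OF tendsto_fst[OF p]] tendsto_snd[OF p]
      by (simp_all add: px_def[abs_def] pl_def[abs_def] pu_def[abs_def] d_eq)
    have n1: "n1 \<longlonglongrightarrow> v1" and n2: "n2 \<longlonglongrightarrow> v2" and n3: "n3 \<longlonglongrightarrow> v3"
      using tendsto_fst[OF tendsto_fst[OF n]] tendsto_snd[OF tendsto_fst[OF n]] tendsto_snd[OF n]
      by (simp_all add: n1_def[abs_def] n2_def[abs_def] n3_def[abs_def] v_eq)
    define lk where "lk k = lbar + t k * pl k" for k
    have lk: "lk \<longlonglongrightarrow> lbar"
      using tendsto_add[OF tendsto_const tendsto_mult[OF t(2) pl]] by (simp add: lk_def[abs_def])
    have lk_pos: "\<forall>\<^sub>F k in sequentially. lk k > 0"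
      using order_tendstoD(1)[OF lk assms(2)] .
    \<comment> \<open>The quotient \<open>(x - u) / l\<close> at the \<open>k\<close>-th base point is \<open>w + t k *\<^sub>R c k\<close> once \<open>lk k > 0\<close>.\<close>
    define c where "c k = (1 / lk k) *\<^sub>R (px k - pu k - pl k *\<^sub>R w)" for k
    define wk where "wk k = w + t k *\<^sub>R c k" for k
    define e where "e = (1 / lbar) *\<^sub>R (dx - du - dl *\<^sub>R w)"
    have c: "c \<longlonglongrightarrow> e"
      unfolding c_def[abs_def] e_def using assms(2) by (intro tendsto_intros px pu pl lk) simp
    have wk: "wk \<longlonglongrightarrow> w"
      using tendsto_add[OF tendsto_const tendsto_scaleR[OF t(2) c]] by (simp add: wk_def[abs_def])
    have wk_eq: "wk k = (1 / lk k) *\<^sub>R ((xbar + t k *\<^sub>R px k) - (u + t k *\<^sub>R pu k))"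
      if "lk k > 0" for k
    proof -
      have xbar: "xbar = u + lbar *\<^sub>R w"
        using assms(2) by (simp add: w_def)
      have "lk k *\<^sub>R wk k = (xbar + t k *\<^sub>R px k) - (u + t k *\<^sub>R pu k)"
        using that unfolding wk_def c_def
        by (simp add: scaleR_add_right) (simp add: xbar lk_def algebra_simps)
      then show ?thesis
        using that by (metis divide_self less_irrefl scaleR_one scaleR_scaleR times_divide_eq_left mult_1)
    qed
    define r where "r k = (1 / t k) *\<^sub>R (gradient \<omega> (wk k) - gradient \<omega> w)" for k
    have r: "r \<longlonglongrightarrow> H w e"
      unfolding r_def[abs_def] wk_def[abs_def] by (rule has_derivative_imp_hadamard[OF H t(2,1) c])
    have "\<forall>k. \<exists>a. \<forall>d. a \<bullet> H (wk k) d = n1 k \<bullet> d"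
      using solve by blast
    then obtain ak where ak: "\<And>k d. ak k \<bullet> H (wk k) d = n1 k \<bullet> d"
      by (auto dest!: choice)
    obtain a where a: "\<And>d. a \<bullet> H w d = v1 \<bullet> d"
      using solve by blast
    have "isCont H w" using cont by (simp add: continuous_on_eq_continuous_at)
    then have ak_lim: "ak \<longlonglongrightarrow> a"
      using coercive_adjoint_solution_tendsto[OF s(1) s(2) isCont_tendsto_compose[OF _ wk] n1 ak a]
      by blast
    have step: "n2 k = - (n1 k \<bullet> wk k) \<and>
        (n1 k + n3 k, lk k *\<^sub>R ak k) \<in> regular_normal_cone ?C ((u, gradient \<omega> w) + t k *\<^sub>R (pu k, r k))"
      if pos: "lk k > 0" for k
    proof -
      have "((n1 k, n2 k), n3 k) \<in>
          regular_normal_cone ?P ((xbar + t k *\<^sub>R px k, lk k), u + t k *\<^sub>R pu k)"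
        using nor[of k]
        by (simp add: n1_def n2_def n3_def lk_def px_def pl_def pu_def plus_prod_def)
      note * = regular_normal_subdifferential_of_prox_map[OF assms(1) pos assms(3) diff H cont
          wk_eq[OF pos] this ak]
      have "(u, gradient \<omega> w) + t k *\<^sub>R (pu k, r k) = (u + t k *\<^sub>R pu k, gradient \<omega> (wk k))"
        using t(1)[of k] by (simp add: r_def)
      with * show ?thesis by simp
    qed
    have "(v1 + v3, lbar *\<^sub>R a) \<in> directional_normal_cone ?C (u, gradient \<omega> w) (du, H w e)"
    proof (rule directional_normal_coneI_eventually[OF t(2)])
      show "(\<lambda>k. (pu k, r k)) \<longlonglongrightarrow> (du, H w e)"
        by (intro tendsto_intros pu r)
      show "(\<lambda>k. (n1 k + n3 k, lk k *\<^sub>R ak k)) \<longlonglongrightarrow> (v1 + v3, lbar *\<^sub>R a)"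
        by (intro tendsto_intros n1 n3 lk ak_lim)
      show "\<forall>\<^sub>F k in sequentially. t k > 0 \<and> (n1 k + n3 k, lk k *\<^sub>R ak k)
          \<in> regular_normal_cone ?C ((u, gradient \<omega> w) + t k *\<^sub>R (pu k, r k))"
        using lk_pos by eventually_elim (use t step in auto)
    qed
    from ss(2)[OF this] have "(v1 + v3) \<bullet> du + lbar * (v1 \<bullet> e) = 0"
      by (simp add: a)
    then have "(v1 + v3) \<bullet> du + v1 \<bullet> (dx - du - dl *\<^sub>R w) = 0"
      using assms(2) by (simp add: e_def)
    moreover have "v2 = - (v1 \<bullet> w)"
    proof (rule LIMSEQ_unique[OF n2])
      have "(\<lambda>k. - (n1 k \<bullet> wk k)) \<longlonglongrightarrow> - (v1 \<bullet> w)"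
        by (intro tendsto_intros n1 wk)
      moreover have "\<forall>\<^sub>F k in sequentially. - (n1 k \<bullet> wk k) = n2 k"
        using lk_pos by eventually_elim (use step in simp)
      ultimately show "n2 \<longlonglongrightarrow> - (v1 \<bullet> w)"
        by (rule Lim_transform_eventually)
    qed
    ultimately show ?thesis
      by (simp add: v_eq d_eq inner_add_left inner_diff_right mult.commute)
  qed
  ultimately show ?thesis
    unfolding semismooth_star_def semismooth_star_set_def u_def by blast
qed

end
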